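(* Let $L=\sum_{i=0}^N a_i(x)\partial_x^i$ be a Bochner differential operator of order $N\ge 1$ with $a_0\equiv 0$, having a sequence of monic eigenpolynomials $\{P_n\}_{n\ge 0}$, $\deg P_n=n$, with corresponding eigenvalues $\{\lambda_n\}_{n\ge 0}\subset\mathbb{C}$, i.e. $LP_n=\lambda_nP_n$ for all $n\geq 0$, where $\lambda_0=0$, $\lambda_n\neq 0$ for $n\ge 1$, and the $\lambda_n$ are pairwise distinct. Let $\{\delta_n^{(k)}\}$ be the sequence associated with $L$, and write $P_n(x)=\sum_{j=0}^n b_{n,j}x^j$ with $b_{n,n}=1$. Then for each $n\ge 1$ and each $1\le i\le n$, $$b_{n,n-i}=\det(H),$$ where $H=(h_{r,c})_{1\le r,c\le i}$ is the upper Hessenberg $i\times i$ matrix with entries $$h_{r,c}=\begin{cases}\dfrac{\delta_{n-r+1}^{(c-r+1)}}{\lambda_n-\lambda_{n-c}}, & r\le c\le r+N-1,\\[2mm] 0, & c\ge r+N,\\ -1, & c=r-1,\\ 0, & c<r-1.\end{cases}$$ That is, the first row of $H$ is $\frac{\delta_n^{(1)}}{\lambda_n-\lambda_{n-1}},\frac{\delta_n^{(2)}}{\lambda_n-\lambda_{n-2}},\dots,\frac{\delta_n^{(N)}}{\lambda_n-\lambda_{n-N}},0,\dots,0$ (truncated to $i$ entries if $i<N$), the second row is $-1,\frac{\delta_{n-1}^{(1)}}{\lambda_n-\lambda_{n-2}},\frac{\delta_{n-1}^{(2)}}{\lambda_n-\lambda_{n-3}},\dots$, and so on, the last diagonal entry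 being $\frac{\delta_{n-i+1}^{(1)}}{\lambda_n-\lambda_{n-i}}$.
   Context: A Bochner differential operator of order $N$ is an operator $L=\sum_{i=0}^N a_i(x)\partial_x^i$, where each $a_i(x)$ is a polynomial with complex coefficients, $\deg a_i\le i$, and $\partial_x^i$ is the $i$-th derivative with respect to $x$. Set $a_n(x)=0$ for $n>N$ and write $a_n(x)=\sum_{i=0}^n a_{n,i}x^i$ with $a_{n,i}\in\mathbb{C}$. The sequence $\{\delta_n^{(k)}\}$ associated with $L$ is $$\delta_n^{(k)}=\sum_{i=k}^{n}\binom{n}{i}\,i!\,a_{i,i-k},\quad n=0,1,2,\dots,\ k=0,1,\dots,n,$$ and $\delta_n^{(k)}=0$ for $k>n$. *)

theory Defs
  imports "HOL-Computational_Algebra.Polynomial" "Jordan_Normal_Form.Determinant"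
begin

text \<open>
  The operator \<open>\<Sum>i\<le>N. a\<^sub>i(x) (d/dx)\<^sup>i\<close> is represented by its coefficient
  sequence \<open>a\<close>, extended by zero beyond \<open>N\<close>.  As \<open>a N \<noteq> 0\<close> is not required, \<open>N\<close> is an
  upper bound for the exact order.
\<close>

definition bochner_coeffs :: "nat \<Rightarrow> (nat \<Rightarrow> complex poly) \<Rightarrow> bool" where
  "bochner_coeffs N a \<longleftrightarrow> (\<forall>i\<le>N. degree (a i) \<le> i) \<and> (\<forall>i>N. a i = 0)"

definition bochner_op :: "nat \<Rightarrow> (nat \<Rightarrow> complex poly) \<Rightarrow> complex poly \<Rightarrow> complex poly" where
  "bochner_op N a p = (\<Sum>i\<le>N. a i * (pderiv ^^ i) p)"

text \<open>\<open>bochner_delta a n k\<close> is \<open>\<delta>\<^sub>n\<^sup>(\<^sup>k\<^sup>)\<close>; for \<open>k > n\<close> the sum is empty, hence zero.\<close>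

definition bochner_delta :: "(nat \<Rightarrow> complex poly) \<Rightarrow> nat \<Rightarrow> nat \<Rightarrow> complex" where
  "bochner_delta a n k =
     (\<Sum>i = k..n. of_nat (n choose i) * fact i * coeff (a i) (i - k))"

text \<open>
  The entries are indexed from 1.  All natural-number subtractions below are exact
  for \<open>1 \<le> r, c \<le> n\<close> and \<open>N \<ge> 1\<close>.
\<close>

definition hessenberg_entry ::
    "nat \<Rightarrow> (nat \<Rightarrow> complex poly) \<Rightarrow> (nat \<Rightarrow> complex) \<Rightarrow> nat \<Rightarrow> nat \<Rightarrow> nat \<Rightarrow> complex" where
  "hessenberg_entry N a ev n r c =
     (if r \<le> c \<and> c \<le> r + N - 1
        then bochner_delta a (n - r + 1) (c - r + 1) / (ev n - ev (n - c))
      else if c \<ge> r + N then 0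
      else if c = r - 1 then -1
      else 0)"

text \<open>Matrices of type \<open>mat\<close> are indexed from 0, whence the shift.\<close>

definition hessenberg_mat ::
    "nat \<Rightarrow> (nat \<Rightarrow> complex poly) \<Rightarrow> (nat \<Rightarrow> complex) \<Rightarrow> nat \<Rightarrow> nat \<Rightarrow> complex mat" where
  "hessenberg_mat N a ev n i =
     mat i i (\<lambda>(r, c). hessenberg_entry N a ev n (r + 1) (c + 1))"

end

theory Submission
  imports Defs
begin

text \<open>
  The operator \<open>L\<close> sends \<open>x\<^sup>m\<close> to \<open>\<Sum>k. \<delta>\<^sub>m\<^sup>(\<^sup>k\<^sup>) x\<^bsup>m-k\<^esup>\<close>
  (\<open>coeff_bochner_op_monom\<close>): it lowers degrees, and its action on monomials is a triangular
  matrix with diagonal \<open>\<delta>\<^sub>m\<^sup>(\<^sup>0\<^sup>)\<close>. Comparing the coefficients of \<open>x\<^sup>n\<close> in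
  \<open>L P\<^sub>n = \<lambda>\<^sub>n P\<^sub>n\<close> identifies this diagonal entry with \<open>\<lambda>\<^sub>n\<close>. Comparing those of
  \<open>x\<^bsup>n-i\<^esup>\<close> then gives
  \<open>(\<lambda>\<^sub>n - \<lambda>\<^bsub>n-i\<^esub>) b\<^bsub>n,n-i\<^esub>
     = \<Sum>r<i. b\<^bsub>n,n-r\<^esub> \<delta>\<^bsub>n-r\<^esub>\<^bsup>(i-r)\<^esup>\<close>,
  so that each coefficient is a combination of all the preceding ones, starting from the leading
  coefficient 1 (\<open>eigenpoly_coeff_recurrence\<close>).

  A full-history linear recurrence of this kind is solved by the determinant of the upper
  Hessenberg matrix of its weights with \<open>-1\<close> on the subdiagonal (\<open>det_unit_hessenberg\<close>).
  The theorem is this fact applied to the weights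
  \<open>\<delta>\<^bsub>n-r\<^esub>\<^bsup>(i-r)\<^esup> / (\<lambda>\<^sub>n - \<lambda>\<^bsub>n-i\<^esub>)\<close>. The band of width \<open>N\<close> in the matrix
  loses nothing because \<open>\<delta>\<^sub>m\<^sup>(\<^sup>k\<^sup>)\<close> vanishes for \<open>k > N\<close>.
\<close>

text \<open>
  Replace the first row of \<open>H\<close> by the combination of all rows with weights
  \<open>b\<^sub>0, \<dots>, b\<^bsub>i-1\<^esub>\<close>; as \<open>b\<^sub>0 = 1\<close>, the determinant does not change. In every column but
  the last one, the \<open>-1\<close> on the subdiagonal cancels the right-hand side of the recurrence, so the
  new first row is \<open>(0, \<dots>, 0, b\<^sub>i)\<close>. Expansion along it leaves an upper triangular minor with
  diagonal \<open>-1\<close>, whose sign is that of the cofactor.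
\<close>

lemma det_unit_hessenberg:
  fixes H :: "'a :: comm_ring_1 mat" and b :: "nat \<Rightarrow> 'a"
  assumes H: "H \<in> carrier_mat i i" and i: "i \<ge> 1"
    and subdiag: "\<And>r. Suc r < i \<Longrightarrow> H $$ (Suc r, r) = -1"
    and below: "\<And>r c. r < i \<Longrightarrow> Suc c < r \<Longrightarrow> H $$ (r, c) = 0"
    and b0: "b 0 = 1"
    and rec: "\<And>c. c < i \<Longrightarrow> b (Suc c) = (\<Sum>r\<le>c. b r * H $$ (r, c))"
  shows "det H = b i"
proof -
  \<comment> \<open>Left multiplication by \<open>T\<close> performs the row operation.\<close>
  define T where "T = mat i i (\<lambda>(r, c). if r = 0 then b c else if r = c then 1 else 0)"
  define M where "M = T * H"
  have T: "T \<in> carrier_mat i i" by (simp add: T_def)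
  have M: "M \<in> carrier_mat i i" using T H by (simp add: M_def)
  have M_entry: "M $$ (r, c) = (\<Sum>s<i. T $$ (r, s) * H $$ (s, c))" if "r < i" "c < i" for r c
    using that T H by (simp add: M_def scalar_prod_def atLeast0LessThan)
  have M_first: "M $$ (0, c) = (if Suc c = i then b i else 0)" if c: "c < i" for c
  proof -
    have "M $$ (0, c) = (\<Sum>s<i. b s * H $$ (s, c))"
      using c by (simp add: M_entry T_def)
    \<comment> \<open>The subdiagonal entry exists except in the last column, where the second set is empty.\<close>
    also have "\<dots> = (\<Sum>s\<in>{..c} \<union> {s. s < i \<and> s = Suc c}. b s * H $$ (s, c))"
    proof (intro sum.mono_neutral_right ballI)
      fix s assume s: "s \<in> {..<i} - ({..c} \<union> {s. s < i \<and> s = Suc c})"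
      then have "s < i" "Suc c < s" by auto
      then show "b s * H $$ (s, c) = 0" by (simp add: below)
    qed (use c in auto)
    also have "\<dots> = b (Suc c) + (\<Sum>s | s < i \<and> s = Suc c. b s * H $$ (s, c))"
      using c by (subst sum.union_disjoint) (auto simp: rec)
    also have "\<dots> = (if Suc c = i then b i else 0)"
    proof (cases "Suc c = i")
      case False
      then have "{s. s < i \<and> s = Suc c} = {Suc c}" using c by auto
      then show ?thesis using False c subdiag[of c] by simp
    next
      case True
      then have "{s. s < i \<and> s = Suc c} = {}" by auto
      then show ?thesis using True by (simp only: sum.empty) simp
    qed
    finally show ?thesis .
  qed
  have M_rest: "M $$ (r, c) = H $$ (r, c)" if "0 < r" "r < i" "c < i" for r c
    using that by (simp add: M_entry T_def if_distrib[of "\<lambda>x. x * _"] cong: if_cong)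
  have detT: "det T = 1"
  proof -
    have "upper_triangular T" by (auto simp: T_def)
    then have "det T = prod_list (diag_mat T)" by (rule det_upper_triangular[OF _ T])
    also have "diag_mat T = map (\<lambda>_. 1) [0..<i]"
      by (auto simp: diag_mat_def T_def b0)
    finally show ?thesis by (simp add: map_replicate_const)
  qed
  define U where "U = mat_delete M 0 (i - 1)"
  have U: "U \<in> carrier_mat (i - 1) (i - 1)"
    unfolding U_def by (rule mat_delete_carrier[OF M])
  have U_entry: "U $$ (r, c) = H $$ (Suc r, c)" if "r < i - 1" "c < i - 1" for r c
    using that M by (simp add: U_def mat_delete_def M_rest)
  have detU: "det U = (-1) ^ (i - 1)"
  proof -
    have "upper_triangular U" using U by (auto simp: U_entry below)
    then have "det U = prod_list (diag_mat U)" by (rule det_upper_triangular[OF _ U])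
    also have "diag_mat U = map (\<lambda>_. -1) [0..<i - 1]"
      using U by (auto simp: diag_mat_def U_entry subdiag)
    finally show ?thesis by (simp add: map_replicate_const)
  qed
  have "det H = det M" using det_mult[OF T H] detT by (simp add: M_def)
  also have "\<dots> = (\<Sum>c<i. M $$ (0, c) * cofactor M 0 c)"
    using laplace_expansion_row[OF M, of 0] i by simp
  also have "\<dots> = (\<Sum>c<i. if c = i - 1 then b i * cofactor M 0 (i - 1) else 0)"
    by (intro sum.cong) (auto simp: M_first)
  also have "\<dots> = b i * cofactor M 0 (i - 1)" using i by simp
  also have "cofactor M 0 (i - 1) = (-1) ^ (i - 1) * det U"
    unfolding cofactor_def U_def by simp
  also have "\<dots> = 1"
    unfolding detU by (simp flip: power_mult_distrib)
  finally show ?thesis by simp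
qed

text \<open>
  The coefficient is the falling factorial \<open>m (m - 1) \<cdots> (m - i + 1)\<close>, here in the form in which it
  occurs in \<open>bochner_delta\<close>. It vanishes for \<open>i > m\<close>, so that the truncated exponent is harmless.
\<close>

lemma higher_pderiv_monom_choose:
  fixes c :: "'a :: {comm_ring_1,semiring_no_zero_divisors,ring_char_0}"
  shows "(pderiv ^^ i) (monom c m) = monom (of_nat (m choose i) * fact i * c) (m - i)"
proof (induction i)
  case (Suc i)
  have "(m choose i) * (m - i) = (m choose Suc i) * Suc i"
    by (metis binomial_absorb_comp binomial_absorption mult.commute)
  then have "(of_nat (m choose i) * of_nat (m - i) :: 'a) = of_nat (m choose Suc i) * of_nat (Suc i)"
    by (metis of_nat_mult)
  then have "of_nat (m - i) * (of_nat (m choose i) * fact i * c) = of_nat (m choose Suc i) * fact (Suc i) * c"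
    by (simp add: algebra_simps)
  then show ?case using Suc by (simp add: pderiv_monom)
qed simp

text \<open>
  The term \<open>a\<^bsub>i,l\<^esub> x\<^sup>l (d/dx)\<^sup>i\<close> lowers the exponent by \<open>i - l\<close>. Hence the contributions of
  \<open>x\<^sup>m\<close> to \<open>x\<^sup>j\<close> come from the coefficients with \<open>i - l = m - j\<close>, and these are the ones that
  \<open>\<delta>\<^sub>m\<^bsup>(m-j)\<^esup>\<close> collects. No exponent is raised, since \<open>deg a\<^sub>i \<le> i\<close>.
\<close>

lemma coeff_bochner_op_monom:
  assumes "bochner_coeffs N a"
  shows "coeff (bochner_op N a (monom c m)) j
       = (if j \<le> m then c * bochner_delta a m (m - j) else 0)"
proof -
  let ?t = "\<lambda>i. of_nat (m choose i) * fact i * coeff (a i) (i - (m - j))"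
  have deg: "coeff (a i) l = 0" if "l > i" for i l
  proof (cases "i \<le> N")
    case True
    then have "degree (a i) \<le> i" using assms by (simp add: bochner_coeffs_def)
    then show ?thesis using that by (intro coeff_eq_0) simp
  next
    case False
    then show ?thesis using assms by (simp add: bochner_coeffs_def)
  qed
  have "coeff (bochner_op N a (monom c m)) j
      = (\<Sum>i\<le>N. coeff (monom (of_nat (m choose i) * fact i * c) (m - i) * a i) j)"
    by (simp add: bochner_op_def higher_pderiv_monom_choose coeff_sum mult.commute)
  also have "\<dots> = (\<Sum>i\<le>N. if m - i \<le> j then of_nat (m choose i) * fact i * c * coeff (a i) (j - (m - i)) else 0)"
    by (intro sum.cong) (auto simp: coeff_monom_mult)
  also have "\<dots> = (if j \<le> m then c * bochner_delta a m (m - j) else 0)"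
  proof (cases "j \<le> m")
    case True
    have "(\<Sum>i\<le>N. if m - i \<le> j then of_nat (m choose i) * fact i * c * coeff (a i) (j - (m - i)) else 0)
        = (\<Sum>i\<le>N. if i \<in> {m - j..m} then c * ?t i else 0)"
    proof (intro sum.cong refl)
      fix i
      show "(if m - i \<le> j then of_nat (m choose i) * fact i * c * coeff (a i) (j - (m - i)) else 0)
          = (if i \<in> {m - j..m} then c * ?t i else 0)"
      proof (cases "i \<in> {m - j..m}")
        case in_range: True
        then have "j - (m - i) = i - (m - j)" "m - i \<le> j" using True by auto
        then show ?thesis using in_range by (simp add: mult_ac)
      next
        case False
        then show ?thesis using True by (auto simp: binomial_eq_0)
      qed
    qed
    also have "\<dots> = (\<Sum>i\<in>{..N} \<inter> {m - j..m}. c * ?t i)"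
      by (simp only: sum.inter_restrict[OF finite_atMost])
    \<comment> \<open>Order bound and summation range need not be comparable: \<open>a\<^sub>i = 0\<close> beyond \<open>N\<close>.\<close>
    also have "\<dots> = (\<Sum>i = m - j..m. c * ?t i)"
      using assms by (intro sum.mono_neutral_left) (auto simp: bochner_coeffs_def)
    finally show ?thesis using True by (simp add: bochner_delta_def sum_distrib_left)
  next
    case False
    have "(of_nat (m choose i) :: complex) * fact i * c * coeff (a i) (j - (m - i)) = 0" for i
      using False by (cases "i \<le> m") (auto simp: deg binomial_eq_0)
    then show ?thesis using False by (simp only: if_False if_cancel sum.neutral_const)
  qed
  finally show ?thesis .
qed

lemma bochner_op_sum: "bochner_op N a (\<Sum>x\<in>A. f x) = (\<Sum>x\<in>A. bochner_op N a (f x))"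
  unfolding bochner_op_def by (simp add: higher_pderiv_sum sum_distrib_left sum.swap[of _ A])

lemma coeff_bochner_op:
  assumes "bochner_coeffs N a" and "degree p \<le> n"
  shows "coeff (bochner_op N a p) j = (\<Sum>m = j..n. coeff p m * bochner_delta a m (m - j))"
proof -
  have "coeff (bochner_op N a p) j = coeff (bochner_op N a (\<Sum>m\<le>n. monom (coeff p m) m)) j"
    by (simp add: poly_as_sum_of_monoms'[OF assms(2)])
  also have "\<dots> = (\<Sum>m\<le>n. if m \<in> {j..n} then coeff p m * bochner_delta a m (m - j) else 0)"
    by (auto simp: bochner_op_sum coeff_sum coeff_bochner_op_monom[OF assms(1)] intro!: sum.cong)
  also have "\<dots> = (\<Sum>m\<in>{..n} \<inter> {j..n}. coeff p m * bochner_delta a m (m - j))"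
    by (simp only: sum.inter_restrict[OF finite_atMost])
  finally show ?thesis by (simp add: Int_absorb1 subset_iff)
qed

lemma bochner_delta_eq_0:
  assumes "bochner_coeffs N a" and "k > N"
  shows "bochner_delta a n k = 0"
  using assms by (simp add: bochner_delta_def bochner_coeffs_def)

lemma bochner_delta_0_eq_eigenvalue:
  assumes "bochner_coeffs N a" and "bochner_op N a p = smult \<mu> p" and "p \<noteq> 0"
  shows "bochner_delta a (degree p) 0 = \<mu>"
  using coeff_bochner_op[OF assms(1) order_refl, of p "degree p"] assms(2,3) by simp

text \<open>
  In the coefficient of \<open>x\<^bsup>n-c-1\<^esup>\<close> of \<open>L p = \<mu> p\<close>, the diagonal term of \<open>L\<close> is moved to the
  side of the eigenvalue. What remains involves only higher coefficients of \<open>p\<close>, listed from the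
  leading one downwards as the rows of the Hessenberg matrix are.
\<close>

lemma eigenpoly_coeff_recurrence:
  assumes bc: "bochner_coeffs N a"
    and eig: "bochner_op N a p = smult \<mu> p" and deg: "degree p = n" and c: "c < n"
  shows "(\<mu> - bochner_delta a (n - Suc c) 0) * coeff p (n - Suc c)
       = (\<Sum>r\<le>c. coeff p (n - r) * bochner_delta a (n - r) (Suc c - r))"
proof -
  let ?j = "n - Suc c"
  let ?f = "\<lambda>m. coeff p m * bochner_delta a m (m - ?j)"
  have "\<mu> * coeff p ?j = (\<Sum>m = ?j..n. ?f m)"
    using coeff_bochner_op[OF bc, of p n ?j] eig deg by simp
  also have "\<dots> = ?f ?j + (\<Sum>m = n - c..n. ?f m)"
    using c by (subst sum.atLeast_Suc_atMost) (auto simp: Suc_diff_Suc)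
  also have "(\<Sum>m = n - c..n. ?f m) = (\<Sum>r\<le>c. ?f (n - r))"
    using c by (intro sum.reindex_bij_witness[of _ "\<lambda>r. n - r" "\<lambda>m. n - m"]) auto
  also have "\<dots> = (\<Sum>r\<le>c. coeff p (n - r) * bochner_delta a (n - r) (Suc c - r))"
    using c by (intro sum.cong refl arg_cong2[where f = "(*)"] arg_cong[where f = "bochner_delta a _"]) auto
  finally show ?thesis by (simp add: algebra_simps)
qed

theorem theorem3:
  fixes N :: nat
    and a :: "nat \<Rightarrow> complex poly"
    and P :: "nat \<Rightarrow> complex poly"
    and ev :: "nat \<Rightarrow> complex"
  assumes "N \<ge> 1"
    and "bochner_coeffs N a"
    and "a 0 = 0"
    and "\<And>n. degree (P n) = n"
    and "\<And>n. lead_coeff (P n) = 1"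
    and "\<And>n. bochner_op N a (P n) = smult (ev n) (P n)"
    and "ev 0 = 0"
    and "\<And>n. n \<ge> 1 \<Longrightarrow> ev n \<noteq> 0"
    and "\<And>m n. m \<noteq> n \<Longrightarrow> ev m \<noteq> ev n"
  shows "\<forall>n\<ge>1. \<forall>i. 1 \<le> i \<and> i \<le> n \<longrightarrow>
           coeff (P n) (n - i) = det (hessenberg_mat N a ev n i)"
proof (intro allI impI, elim conjE)
  fix n i :: nat
  assume i: "1 \<le> i" "i \<le> n"
  let ?H = "hessenberg_mat N a ev n i"
  have "P m \<noteq> 0" for m using assms(5)[of m] by auto
  then have delta_0: "bochner_delta a m 0 = ev m" for m
    using bochner_delta_0_eq_eigenvalue[OF assms(2,6), of m] assms(4) by simp
  \<comment> \<open>On and above the diagonal, the band condition may be dropped.\<close>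
  have entry: "?H $$ (r, c) = bochner_delta a (n - r) (Suc c - r) / (ev n - ev (n - Suc c))"
    if "r \<le> c" "c < i" for r c
  proof (cases "Suc c - r \<le> N")
    case True
    have "n - Suc r + 1 = n - r" "Suc c \<le> r + N" "Suc c - r = Suc (c - r)"
      using True that i by auto
    then show ?thesis
      using that by (simp add: hessenberg_mat_def hessenberg_entry_def)
  next
    case False
    then show ?thesis
      using that by (simp add: hessenberg_mat_def hessenberg_entry_def bochner_delta_eq_0[OF assms(2)])
  qed
  have "det ?H = coeff (P n) (n - i)"
  proof (rule det_unit_hessenberg[where b = "\<lambda>j. coeff (P n) (n - j)"])
    fix c assume c: "c < i"
    then have "ev n \<noteq> ev (n - Suc c)" using i by (intro assms(9)) simp
    then have "coeff (P n) (n - Suc c) =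
        (\<Sum>r\<le>c. coeff (P n) (n - r) * bochner_delta a (n - r) (Suc c - r)) / (ev n - ev (n - Suc c))"
      using eigenpoly_coeff_recurrence[OF assms(2,6,4), of c n] c i
      by (simp add: delta_0 field_simps)
    also have "\<dots> = (\<Sum>r\<le>c. coeff (P n) (n - r) * ?H $$ (r, c))"
      using c by (simp add: sum_divide_distrib entry)
    finally show "coeff (P n) (n - Suc c) = (\<Sum>r\<le>c. coeff (P n) (n - r) * ?H $$ (r, c))" .
  next
    show "coeff (P n) (n - 0) = 1" using assms(4,5)[of n] by simp
  qed (use i in \<open>auto simp: hessenberg_mat_def hessenberg_entry_def\<close>)
  then show "coeff (P n) (n - i) = det ?H" ..
qed

end
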